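(* Let $G=(V,E)$ be a finite, connected, simple (undirected) graph. Trap on $G$ starting from $v\in V$ is a win for the first player if and only if $v$ is contained in all maximum-cardinality matchings of $G$ (i.e. $v$ is incident to an edge of every maximum-cardinality matching).
   Context: Trap: a token starts at an initial vertex of the graph; two players alternately move it along an incident edge to a vertex never visited before by the token (the initial vertex counts as visited). A player who has no possible move loses and the other wins. The game is a win for a player if that player has a winning strategy, i.e. a strategy that results in a win whatever the opponent does. A matching is a set of edges no two of which share a vertex; a vertex is contained in a matching if it is incident to one of its edges. *)

theory Defs
  imports Main
begin

definition finite_simple_graph :: "'a set \<Rightarrow> 'a set set \<Rightarrow> bool" where
  "finite_simple_graph V E \<longleftrightarrow> finite V \<and> (\<forall>e\<in>E. e \<subseteq> V \<and> card e = 2)"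

definition connected_graph :: "'a set \<Rightarrow> 'a set set \<Rightarrow> bool" where
  "connected_graph V E \<longleftrightarrow>
     V \<noteq> {} \<and> (\<forall>u\<in>V. \<forall>w\<in>V. (\<lambda>x y. {x, y} \<in> E)\<^sup>*\<^sup>* u w)"

definition matching :: "'a set set \<Rightarrow> 'a set set \<Rightarrow> bool" where
  "matching E M \<longleftrightarrow> M \<subseteq> E \<and> (\<forall>e\<in>M. \<forall>f\<in>M. e \<noteq> f \<longrightarrow> e \<inter> f = {})"

definition maximum_matching :: "'a set set \<Rightarrow> 'a set set \<Rightarrow> bool" where
  "maximum_matching E M \<longleftrightarrow>
     matching E M \<and> (\<forall>N. matching E N \<longrightarrow> card N \<le> card M)"

definition contained_in_matching :: "'a \<Rightarrow> 'a set set \<Rightarrow> bool" where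
  "contained_in_matching v M \<longleftrightarrow> (\<exists>e\<in>M. v \<in> e)"

text \<open>
  A position of Trap is the nonempty list of the vertices visited so far, in order of
  visit: its head is the initial vertex, its last element is where the token stands.
  The first player moves when the list has length 1, 3, 5, and so on.
\<close>

datatype player = First | Second

definition to_move :: "'a list \<Rightarrow> player" where
  "to_move h = (if odd (length h) then First else Second)"

definition legal_moves :: "'a set set \<Rightarrow> 'a list \<Rightarrow> 'a set" where
  "legal_moves E h = {w. {last h, w} \<in> E \<and> w \<notin> set h}"

text \<open>
  A strategy may depend on the whole history. The positions that can be
  reached from \<open>v\<close> when player \<open>P\<close> follows \<open>\<sigma>\<close> and the opponent
  plays arbitrary legal moves:
\<close>

inductive reachable :: "'a set set \<Rightarrow> 'a \<Rightarrow> player \<Rightarrow> ('a list \<Rightarrow> 'a) \<Rightarrow> 'a list \<Rightarrow> bool"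
  for E :: "'a set set" and v :: 'a and P :: player and \<sigma> :: "'a list \<Rightarrow> 'a" where
  start: "reachable E v P \<sigma> [v]"
| own_move: "reachable E v P \<sigma> (h @ [\<sigma> h])"
    if "reachable E v P \<sigma> h" "to_move h = P" "\<sigma> h \<in> legal_moves E h"
| opponent_move: "reachable E v P \<sigma> (h @ [w])"
    if "reachable E v P \<sigma> h" "to_move h \<noteq> P" "w \<in> legal_moves E h"

text \<open>
  The first conjunct makes the strategy a legal one: it has to name a legal move
  whenever there is one. The second says that every finished play is a win for \<open>P\<close>,
  i.e. that it is the opponent who is unable to move. Visited vertices are never repeated,
  so on a finite graph every play does finish.
\<close>

definition winning_strategy :: "'a set set \<Rightarrow> 'a \<Rightarrow> player \<Rightarrow> ('a list \<Rightarrow> 'a) \<Rightarrow> bool" where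
  "winning_strategy E v P \<sigma> \<longleftrightarrow>
     (\<forall>h. reachable E v P \<sigma> h \<longrightarrow>
        (to_move h = P \<and> legal_moves E h \<noteq> {} \<longrightarrow> \<sigma> h \<in> legal_moves E h) \<and>
        (legal_moves E h = {} \<longrightarrow> to_move h \<noteq> P))"

definition trap_win :: "'a set set \<Rightarrow> 'a \<Rightarrow> player \<Rightarrow> bool" where
  "trap_win E v P \<longleftrightarrow> (\<exists>\<sigma>. winning_strategy E v P \<sigma>)"

end

theory Submission
  imports Defs
begin

text \<open>
  The player who has just moved wins whenever the token stands on a vertex \<open>x\<close> missed by
  some maximum matching \<open>N\<close>. The opponent's next vertex \<open>y\<close> must be covered by \<open>N\<close>, since
  otherwise \<open>{x, y}\<close> could be added to it; the reply is the partner \<open>z\<close> of \<open>y\<close>. Exchanging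
  \<open>{y, z}\<close> for \<open>{x, y}\<close> yields a maximum matching that misses \<open>z\<close>, so the situation
  recurs (\<open>exchange_partner\<close>). No edge of the new matching joins a visited vertex to an
  unvisited one, which is why later partners are always unvisited. Carrying the exchanged
  matching along in the invariant replaces the usual argument with long alternating paths
  (\<open>paired_position_reply\<close>).

  If some maximum matching misses the initial vertex \<open>v\<close>, this applies to the second player
  from the start. If all maximum matchings cover \<open>v\<close>, the first player moves to the partner
  \<open>x\<close> of \<open>v\<close> in one of them, \<open>M\<close>. Then \<open>M\<close> without \<open>{v, x}\<close> is a maximum matching of the
  graph with \<open>v\<close> deleted: a larger one would be a maximum matching of the whole graph
  missing \<open>v\<close>. It misses \<open>x\<close>, and the rest of the play takes place in the smaller graph, so
  the same argument applies to the first player there. The equivalence follows because the two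
  players cannot both have winning strategies (\<open>not_both_win\<close>).
\<close>

section \<open>Strategies\<close>

lemma to_move_append [simp]: "to_move (h @ [w]) = P \<longleftrightarrow> to_move h \<noteq> P"
  by (cases P) (auto simp: to_move_def)

text \<open>
  \<open>L\<close> stands for a property of positions in which the opponent of \<open>P\<close> has to move and which
  \<open>P\<close> can restore with each reply. A player who always has a legal move never loses, so
  finished plays need no separate treatment.
\<close>

lemma trap_win_by_invariant:
  assumes own_start: "to_move [v] = P \<Longrightarrow> \<exists>w\<in>legal_moves E [v]. L [v, w]"
    and opponent_start: "to_move [v] \<noteq> P \<Longrightarrow> L [v]"
    and reply: "\<And>h w. h \<noteq> [] \<Longrightarrow> to_move h \<noteq> P \<Longrightarrow> L h \<Longrightarrow> w \<in> legal_moves E h \<Longrightarrow>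
      \<exists>x\<in>legal_moves E (h @ [w]). L (h @ [w, x])"
  shows "trap_win E v P"
proof -
  define \<sigma> where "\<sigma> h = (SOME w. w \<in> legal_moves E h \<and> L (h @ [w]))" for h
  have \<sigma>: "\<sigma> h \<in> legal_moves E h \<and> L (h @ [\<sigma> h])" if "\<exists>w\<in>legal_moves E h. L (h @ [w])" for h
    unfolding \<sigma>_def by (rule someI_ex) (use that in auto)
  have "h \<noteq> [] \<and> (if to_move h = P then \<exists>w\<in>legal_moves E h. L (h @ [w]) else L h)"
    if "reachable E v P \<sigma> h" for h
    using that
  proof induction
    case start
    then show ?case using own_start opponent_start by simp
  next
    case (own_move h)
    then show ?case using \<sigma> by simp
  next
    case (opponent_move h w)
    then show ?case using reply[of h w] by simp
  qed
  then have "winning_strategy E v P \<sigma>"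
    unfolding winning_strategy_def using \<sigma> by fastforce
  then show ?thesis unfolding trap_win_def by blast
qed

lemma reachable_distinct_subset:
  assumes "reachable E v P \<sigma> h" and "finite_simple_graph V E" and "v \<in> V"
  shows "distinct h \<and> set h \<subseteq> V"
  using assms(1)
proof induction
  case start
  then show ?case using \<open>v \<in> V\<close> by simp
next
  case (own_move h)
  then show ?case using assms(2) unfolding finite_simple_graph_def legal_moves_def by auto
next
  case (opponent_move h w)
  then show ?case using assms(2) unfolding finite_simple_graph_def legal_moves_def by auto
qed

text \<open>
  A longest position consistent with both strategies would have to be finished, and then
  each strategy would claim that the other player is the one to move.
\<close>

lemma not_both_win:
  assumes graph: "finite_simple_graph V E" "v \<in> V"
    and "trap_win E v First" and "trap_win E v Second"
  shows False
proof -
  obtain \<sigma> \<tau> where \<sigma>: "winning_strategy E v First \<sigma>" and \<tau>: "winning_strategy E v Second \<tau>"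
    using assms unfolding trap_win_def by blast
  define R where "R h \<longleftrightarrow> reachable E v First \<sigma> h \<and> reachable E v Second \<tau> h" for h
  have R_start: "R [v]" unfolding R_def by (simp add: reachable.start)
  have bound: "length h < Suc (card V)" if "R h" for h
  proof -
    have "distinct h" "set h \<subseteq> V"
      using reachable_distinct_subset[OF _ graph] that unfolding R_def by auto
    then have "length h \<le> card V"
      using graph(1) unfolding finite_simple_graph_def by (metis card_mono distinct_card)
    then show ?thesis by simp
  qed
  obtain h where h: "R h" and longest: "\<And>g. R g \<Longrightarrow> length g \<le> length h"
    using ex_has_greatest_nat[of R "[v]" length "Suc (card V)"] R_start bound by auto
  have longer: False if "R (h @ [w])" for w
    using longest[OF that] by simp
  show False
  proof (cases "to_move h")
    case First
    with h \<sigma> \<tau> have "\<sigma> h \<in> legal_moves E h"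
      unfolding R_def winning_strategy_def by blast
    with First h have "R (h @ [\<sigma> h])"
      unfolding R_def by (auto intro: reachable.intros)
    then show False by (rule longer)
  next
    case Second
    with h \<sigma> \<tau> have "\<tau> h \<in> legal_moves E h"
      unfolding R_def winning_strategy_def by blast
    with Second h have "R (h @ [\<tau> h])"
      unfolding R_def by (auto intro: reachable.intros)
    then show False by (rule longer)
  qed
qed

section \<open>Matchings\<close>

lemma ex_maximum_matching:
  assumes "finite E"
  shows "\<exists>M. maximum_matching E M"
proof -
  have "matching E {}" by (simp add: matching_def)
  moreover have "card N < Suc (card E)" if "matching E N" for N
    using that card_mono[OF assms] by (simp add: matching_def less_Suc_eq_le)
  ultimately show ?thesis
    using ex_has_greatest_nat[of "matching E" "{}" card "Suc (card E)"]
    unfolding maximum_matching_def by auto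
qed

lemma matching_disjoint:
  "matching E M \<Longrightarrow> e \<in> M \<Longrightarrow> f \<in> M \<Longrightarrow> e \<noteq> f \<Longrightarrow> e \<inter> f = {}"
  unfolding matching_def by blast

lemma matching_insert:
  assumes "matching E M" and "e \<in> E" and "e \<inter> \<Union>M = {}"
  shows "matching E (insert e M)"
  using assms unfolding matching_def by blast

lemma matching_Diff: "matching E M \<Longrightarrow> matching E (M - X)"
  unfolding matching_def by blast

text \<open>
  The path with edges \<open>{x, y}\<close> and \<open>{y, z}\<close> is alternating for \<open>N\<close> and starts at a missed
  vertex, so switching it preserves the cardinality and moves the missed vertex from \<open>x\<close> to
  \<open>z\<close>. This is one round of play as seen from the matching.
\<close>

lemma exchange_partner:
  assumes fin: "finite F" and edges: "\<forall>e\<in>F. card e = 2"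
    and max: "maximum_matching F N" and missed: "x \<notin> \<Union>N" and edge: "{x, y} \<in> F"
  obtains z where "{y, z} \<in> N" and "z \<noteq> x" and "z \<noteq> y"
    and "maximum_matching F (insert {x, y} (N - {{y, z}}))"
    and "z \<notin> \<Union>(insert {x, y} (N - {{y, z}}))"
proof -
  have N: "matching F N" and biggest: "\<And>M. matching F M \<Longrightarrow> card M \<le> card N"
    using max unfolding maximum_matching_def by auto
  have NF: "N \<subseteq> F" using N unfolding matching_def by blast
  have finN: "finite N" using NF fin by (rule finite_subset)
  have new: "{x, y} \<notin> N" using missed by blast
  have "y \<in> \<Union>N"
  proof (rule ccontr)
    assume "y \<notin> \<Union>N"
    then have "matching F (insert {x, y} N)"
      using matching_insert[OF N edge] missed by blast
    then have "card (insert {x, y} N) \<le> card N" by (rule biggest)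
    then show False using new finN by simp
  qed
  then obtain e where e: "e \<in> N" "y \<in> e" by blast
  then have "card e = 2" using NF edges by blast
  then obtain z where z: "e = {y, z}" "z \<noteq> y"
    using e(2) by (auto simp: card_2_iff)
  let ?N = "insert {x, y} (N - {{y, z}})"
  have zx: "z \<noteq> x" using e(1) z(1) missed by blast
  have apart: "f \<inter> {y, z} = {}" if "f \<in> N - {{y, z}}" for f
    using matching_disjoint[OF N, of f "{y, z}"] e(1) z(1) that by simp
  have "{x, y} \<inter> \<Union>(N - {{y, z}}) = {}" using apart missed by blast
  then have "matching F ?N" using matching_insert[OF matching_Diff[OF N] edge] by blast
  moreover have "card ?N = card N"
    using new finN card.remove[of N "{y, z}"] e(1) z(1) by simp
  ultimately have "maximum_matching F ?N"
    using biggest unfolding maximum_matching_def by simp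
  moreover have "z \<notin> \<Union>?N" using apart zx z(2) by blast
  ultimately show thesis using that e(1) z zx by blast
qed

text \<open>
  By deleting \<open>v\<close> the matching number drops by exactly one, which is where the hypothesis that
  all maximum matchings cover \<open>v\<close> enters.
\<close>

lemma maximum_matching_delete_vertex:
  assumes fin: "finite E" and max: "maximum_matching E M" and e: "e \<in> M" "v \<in> e"
    and covered: "\<forall>M. maximum_matching E M \<longrightarrow> contained_in_matching v M"
  shows "maximum_matching {f \<in> E. v \<notin> f} (M - {e})"
proof -
  have M: "matching E M" and biggest: "\<And>N. matching E N \<Longrightarrow> card N \<le> card M"
    using max unfolding maximum_matching_def by auto
  have finM: "finite M" using M fin finite_subset unfolding matching_def by blast
  have "matching {f \<in> E. v \<notin> f} (M - {e})"
    using M e unfolding matching_def by blast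
  moreover have "card N \<le> card (M - {e})" if "matching {f \<in> E. v \<notin> f} N" for N
  proof -
    have N: "matching E N" and avoids: "\<not> contained_in_matching v N"
      using that unfolding matching_def contained_in_matching_def by blast+
    from avoids covered have "\<not> maximum_matching E N" by blast
    then have "card N \<noteq> card M"
      using N biggest unfolding maximum_matching_def by auto
    with biggest[OF N] show ?thesis using finM e(1) by simp
  qed
  ultimately show ?thesis unfolding maximum_matching_def by blast
qed

section \<open>The pairing strategy\<close>

text \<open>
  The positions from which the pairing strategy works for the player who is not to move. The
  set \<open>A\<close> of deleted vertices consists of visited ones other than the current one, so that no
  later move uses an edge outside \<open>F\<close>. The last clause ensures that an unvisited vertex never has a visited partner.
\<close>

definition paired_position :: "'a set set \<Rightarrow> 'a set \<Rightarrow> 'a list \<Rightarrow> bool" where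
  "paired_position E A h \<longleftrightarrow> A \<subseteq> set h \<and> last h \<notin> A \<and>
     (let F = {e \<in> E. e \<inter> A = {}} in
      \<exists>N. maximum_matching F N \<and> last h \<notin> \<Union>N \<and>
          (\<forall>e\<in>N. e \<inter> set h \<noteq> {} \<longrightarrow> e \<subseteq> set h))"

lemma paired_position_reply:
  assumes fin: "finite E" and edges: "\<forall>e\<in>E. card e = 2"
    and h: "h \<noteq> []" "paired_position E A h" and w: "w \<in> legal_moves E h"
  shows "\<exists>x\<in>legal_moves E (h @ [w]). paired_position E A (h @ [w, x])"
proof -
  define F where "F = {e \<in> E. e \<inter> A = {}}"
  obtain N where A: "A \<subseteq> set h" "last h \<notin> A" and max: "maximum_matching F N"
    and missed: "last h \<notin> \<Union>N" and closed: "\<forall>e\<in>N. e \<inter> set h \<noteq> {} \<longrightarrow> e \<subseteq> set h"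
    using h(2) unfolding paired_position_def F_def Let_def by blast
  have w': "{last h, w} \<in> E" "w \<notin> set h"
    using w unfolding legal_moves_def by auto
  then have edge: "{last h, w} \<in> F" using A unfolding F_def by blast
  have finF: "finite F" and edgesF: "\<forall>e\<in>F. card e = 2"
    using fin edges unfolding F_def by auto
  obtain z where z: "{w, z} \<in> N" "z \<noteq> last h" "z \<noteq> w"
    and max': "maximum_matching F (insert {last h, w} (N - {{w, z}}))"
    and missed': "z \<notin> \<Union>(insert {last h, w} (N - {{w, z}}))"
    using exchange_partner[OF finF edgesF max missed edge] by blast
  let ?N = "insert {last h, w} (N - {{w, z}})"
  have unvisited: "z \<notin> set h" using bspec[OF closed z(1)] w'(2) by auto
  have "{w, z} \<in> E"
    using z(1) max unfolding maximum_matching_def matching_def F_def by auto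
  then have legal: "z \<in> legal_moves E (h @ [w])"
    using unvisited z(3) unfolding legal_moves_def by simp
  have N: "matching F N" using max unfolding maximum_matching_def by blast
  have "e \<subseteq> set (h @ [w, z])" if e: "e \<in> ?N" "e \<inter> set (h @ [w, z]) \<noteq> {}" for e
  proof (cases "e = {last h, w}")
    case True
    then show ?thesis using h(1) by simp
  next
    case False
    then have "e \<in> N" "e \<noteq> {w, z}" using e(1) by auto
    then have "e \<inter> {w, z} = {}" using matching_disjoint[OF N] z(1) by simp
    then have "e \<inter> set h \<noteq> {}" using e(2) by auto
    then show ?thesis using closed \<open>e \<in> N\<close> by auto
  qed
  then have "paired_position E A (h @ [w, z])"
    unfolding paired_position_def Let_def F_def[symmetric]
    using A(1) unvisited max' missed' by (intro conjI exI[of _ ?N]) auto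
  then show ?thesis using legal by blast
qed

text \<open>
  Both halves of the theorem are instances: no vertices deleted for the second player, and
  the initial vertex deleted for the first player, whose opening move is a choice of partner.
\<close>

lemma trap_win_of_missed:
  assumes "finite E" and "\<forall>e\<in>E. card e = 2"
    and "to_move [v] = P \<Longrightarrow> \<exists>w\<in>legal_moves E [v]. paired_position E A [v, w]"
    and "to_move [v] \<noteq> P \<Longrightarrow> paired_position E A [v]"
  shows "trap_win E v P"
  using assms(3,4) paired_position_reply[OF assms(1,2)]
  by (rule trap_win_by_invariant)

theorem proposition4:
  fixes V :: "'a set" and E :: "'a set set" and v :: 'a
  assumes "finite_simple_graph V E"
    and "connected_graph V E"
    and "v \<in> V"
  shows "trap_win E v First \<longleftrightarrow>
    (\<forall>M. maximum_matching E M \<longrightarrow> contained_in_matching v M)"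
proof
  have edges: "\<forall>e\<in>E. card e = 2" and "E \<subseteq> Pow V" and "finite V"
    using assms(1) unfolding finite_simple_graph_def by auto
  then have fin: "finite E" by (meson finite_Pow_iff finite_subset)
  have first: "to_move [v] = First" by (simp add: to_move_def)
  {
    assume win: "trap_win E v First"
    show "\<forall>M. maximum_matching E M \<longrightarrow> contained_in_matching v M"
    proof (intro allI impI, rule ccontr)
      fix M assume M: "maximum_matching E M" and "\<not> contained_in_matching v M"
      then have "v \<notin> \<Union>M" unfolding contained_in_matching_def by blast
      with M have "paired_position E {} [v]"
        unfolding paired_position_def by auto
      then have "trap_win E v Second"
        using trap_win_of_missed[OF fin edges, of v Second "{}"] first by simp
      with assms(1,3) win show False by (rule not_both_win)
    qed
  next
    assume covered: "\<forall>M. maximum_matching E M \<longrightarrow> contained_in_matching v M"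
    obtain M where M: "maximum_matching E M" using ex_maximum_matching[OF fin] ..
    then obtain e where e: "e \<in> M" "v \<in> e"
      using covered unfolding contained_in_matching_def by blast
    have matching: "matching E M" using M unfolding maximum_matching_def by blast
    then have "e \<in> E" using e(1) unfolding matching_def by blast
    then have "card e = 2" using edges by blast
    then obtain x where x: "e = {v, x}" "x \<noteq> v"
      using e(2) by (auto simp: card_2_iff)
    have legal: "x \<in> legal_moves E [v]"
      using \<open>e \<in> E\<close> x unfolding legal_moves_def by simp
    have apart: "f \<inter> {v, x} = {}" if "f \<in> M - {e}" for f
      using matching_disjoint[OF matching, of f e] e(1) x(1) that by simp
    have "maximum_matching {f \<in> E. f \<inter> {v} = {}} (M - {e})"
      using maximum_matching_delete_vertex[OF fin M e covered] by simp
    then have "paired_position E {v} [v, x]"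
      unfolding paired_position_def Let_def using apart x(2)
      by (intro conjI exI[of _ "M - {e}"]) auto
    then show "trap_win E v First"
      using trap_win_of_missed[OF fin edges, of v First "{v}"] first legal by blast
  }
qed

end
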